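(* Consider the isotropic case $\Sigma=I_p$, with signal energy $\rho^2\ge0$ and noise variance $\sigma^2\ge0$. For all $\phi\in(0,\infty)$, $$\min_{\phi_s\ge\phi}\mathscr R^{\mathrm{sub}}_{0,\infty}(\phi,\phi_s)=\min_{\lambda\ge0}\mathscr R^{\mathrm{sub}}_{\lambda,1}(\phi,\phi),$$ i.e. the optimal limiting risk of the subagged ridgeless predictor (infinitely many bags, optimized over the subsample aspect ratio $\phi_s$) equals the optimal limiting risk of the ridge predictor trained on the full data (optimized over $\lambda$).
   Context: For $\lambda>0,\theta\in(0,\infty)$, $v(-\lambda;\theta)$ is the unique nonnegative solution of $\frac1v=\lambda+\frac{\theta}{1+v}$; $v(0;\theta)=\lim_{\lambda\to0^+}v(-\lambda;\theta)$ for $\theta>1$ (equal to $1/(\theta-1)$) and $+\infty$ for $\theta\in(0,1]$. With $v=v(-\lambda;\theta)$ and $\vartheta\le\theta$, $$\widetilde v(-\lambda;\vartheta,\theta)=\frac{\vartheta(1+v)^{-2}}{v^{-2}-\vartheta(1+v)^{-2}},\qquad\widetilde c(-\lambda;\theta)=\frac1{(1+v)^2},$$ $B_\lambda(\vartheta,\theta)=\rho^2(1+\widetilde v(-\lambda;\vartheta,\theta))\widetilde c(-\lambda;\theta)$, $V_\lambda(\vartheta,\theta)=\sigma^2\widetilde v(-\lambda;\vartheta,\theta)$. (These are the general limiting bias/variance functions specialized to limiting spectral distributions $H=G=\delta_1$.) At $\theta=\infty$: $\widetilde v=0$, $\widetilde c=1$. For $\lambda=0$, $\theta\le1$: $B_0(\vartheta,\theta)=0$;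 $V_0(\vartheta,\theta)=\sigma^2\vartheta/(1-\vartheta)$ for $\theta<1$; $V_0(\vartheta,1)=\infty$ if $\sigma^2>0$ and $0$ if $\sigma^2=0$. $\mathscr R^{\mathrm{sub}}_{0,\infty}(\phi,\phi_s)=\sigma^2+B_0(\phi,\phi_s)+V_0(\phi,\phi_s)$ for $\phi_s\in[\phi,\infty]$, and $\mathscr R^{\mathrm{sub}}_{\lambda,1}(\phi,\phi)=\sigma^2+B_\lambda(\phi,\phi)+V_\lambda(\phi,\phi)$. The minimum over $\lambda\ge0$ is understood as an infimum in the degenerate case $\rho^2=0$, $\sigma^2>0$. *)

theory Defs
  imports "HOL-Analysis.Analysis"
begin

text \<open>
  Asymptotic bias and variance of (subagged) ridge predictors for isotropic features.
  Here \<open>lam \<ge> 0\<close> is the ridge penalty, \<open>\<phi>\<close> the data aspect ratio and \<open>\<theta> \<ge> \<phi>\<close> the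
  subsample aspect ratio, which may be infinite. Functions usually written with argument
  \<open>-lam\<close>, such as \<open>v(-lam; \<theta>)\<close>, take \<open>lam\<close> itself as argument.
\<close>

definition v_pos :: "real \<Rightarrow> real \<Rightarrow> real" where
  "v_pos lam \<theta> = (THE v. v \<ge> 0 \<and> 1 / v = lam + \<theta> / (1 + v))"

text \<open>The convention \<open>1 / 0 = 0\<close> does not make \<open>v = 0\<close> a solution, so the description in
  \<open>v_pos\<close> is proper:\<close>

lemma v_pos_ex1:
  fixes lam \<theta> :: real
  assumes "lam > 0" "\<theta> > 0"
  shows "\<exists>!v. v \<ge> 0 \<and> 1 / v = lam + \<theta> / (1 + v)"
proof -
  define b where "b = lam + \<theta> - 1"
  define D where "D = b\<^sup>2 + 4 * lam"
  define w where "w = (sqrt D - b) / (2 * lam)"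
  have D: "D > b\<^sup>2" using assms by (simp add: D_def)
  then have "sqrt D > \<bar>b\<bar>" by (metis real_sqrt_abs real_sqrt_less_iff)
  then have w: "w > 0" using assms by (simp add: w_def)
  have D0: "D \<ge> 0" using D zero_le_power2[of b] by linarith
  have key: "1 / v = lam + \<theta> / (1 + v) \<longleftrightarrow> lam * v\<^sup>2 + b * v = 1" if "v > 0" for v :: real
    using that by (simp add: b_def field_simps power2_eq_square) argo
  have "2 * lam * w + b = sqrt D" using assms by (simp add: w_def)
  then have "(2 * lam * w + b)\<^sup>2 = D" using D0 by simp
  then have "4 * lam * (lam * w\<^sup>2 + b * w - 1) = 0"
    by (simp add: D_def power2_eq_square algebra_simps)
  then have quad: "lam * w\<^sup>2 + b * w = 1" using assms by simp
  show ?thesis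
  proof (rule ex1I[of _ w])
    show "w \<ge> 0 \<and> 1 / w = lam + \<theta> / (1 + w)" using w key quad by simp
  next
    fix u assume u: "u \<ge> 0 \<and> 1 / u = lam + \<theta> / (1 + u)"
    have "u \<noteq> 0" using u assms by auto
    then have u0: "u > 0" using u by simp
    then have "lam * u\<^sup>2 + b * u = 1" using key u by simp
    then have "(u - w) * (lam * (u + w) + b) = 0"
      using quad by (simp add: power2_eq_square algebra_simps)
    moreover have "lam * (u + w) + b > 0"
    proof -
      have "w * (lam * w + b) = 1" using quad by (simp add: power2_eq_square algebra_simps)
      then have "lam * w + b > 0" using w by (metis zero_less_mult_pos zero_less_one)
      moreover have "lam * u > 0" using u0 assms by simp
      ultimately show ?thesis by (simp add: algebra_simps)
    qed
    ultimately show "u = w" by simp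
  qed
qed

definition v_fp :: "real \<Rightarrow> real \<Rightarrow> ereal" where
  "v_fp lam \<theta> =
    (if lam > 0 then ereal (v_pos lam \<theta>)
     else if \<theta> > 1 then ereal (Lim (at_right 0) (\<lambda>l. v_pos l \<theta>))
     else \<infinity>)"

text \<open>In \<open>v_tilde\<close> and \<open>c_tilde\<close> the case \<open>v = \<infinity>\<close> (\<open>lam = 0\<close>, \<open>\<theta> \<le> 1\<close>) is irrelevant:
  \<open>bias_lim\<close> and \<open>var_lim\<close> treat it separately.\<close>

definition v_tilde :: "real \<Rightarrow> real \<Rightarrow> ereal \<Rightarrow> real" where
  "v_tilde lam \<phi> \<theta> =
    (if \<theta> = \<infinity> then 0
     else let v = real_of_ereal (v_fp lam (real_of_ereal \<theta>))
          in (\<phi> / (1 + v)\<^sup>2) / (1 / v\<^sup>2 - \<phi> / (1 + v)\<^sup>2))"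

definition c_tilde :: "real \<Rightarrow> ereal \<Rightarrow> real" where
  "c_tilde lam \<theta> =
    (if \<theta> = \<infinity> then 1
     else let v = real_of_ereal (v_fp lam (real_of_ereal \<theta>)) in 1 / (1 + v)\<^sup>2)"

definition bias_lim :: "real \<Rightarrow> real \<Rightarrow> real \<Rightarrow> ereal \<Rightarrow> ereal" where
  "bias_lim \<rho> lam \<phi> \<theta> =
    (if lam = 0 \<and> \<theta> \<le> 1 then 0
     else ereal (\<rho>\<^sup>2 * (1 + v_tilde lam \<phi> \<theta>) * c_tilde lam \<theta>))"

definition var_lim :: "real \<Rightarrow> real \<Rightarrow> real \<Rightarrow> ereal \<Rightarrow> ereal" where
  "var_lim \<sigma> lam \<phi> \<theta> =
    (if lam = 0 \<and> \<theta> < 1 then ereal (\<sigma>\<^sup>2 * \<phi> / (1 - \<phi>))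
     else if lam = 0 \<and> \<theta> = 1 then (if \<sigma>\<^sup>2 > 0 then \<infinity> else 0)
     else ereal (\<sigma>\<^sup>2 * v_tilde lam \<phi> \<theta>))"

text \<open>Limiting risk of the ridgeless predictor subagged over infinitely many bags
  (\<open>lam = 0\<close>, \<open>M = \<infinity>\<close>) with subsample aspect ratio \<open>\<theta> \<ge> \<phi>\<close>.\<close>

definition risk_subagged_ridgeless :: "real \<Rightarrow> real \<Rightarrow> real \<Rightarrow> ereal \<Rightarrow> ereal" where
  "risk_subagged_ridgeless \<rho> \<sigma> \<phi> \<theta> = ereal (\<sigma>\<^sup>2) + bias_lim \<rho> 0 \<phi> \<theta> + var_lim \<sigma> 0 \<phi> \<theta>"

text \<open>Limiting risk of the single (\<open>M = 1\<close>) ridge predictor trained on the full data.\<close>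

definition risk_full_ridge :: "real \<Rightarrow> real \<Rightarrow> real \<Rightarrow> real \<Rightarrow> ereal" where
  "risk_full_ridge \<rho> \<sigma> lam \<phi> =
    ereal (\<sigma>\<^sup>2) + bias_lim \<rho> lam \<phi> (ereal \<phi>) + var_lim \<sigma> lam \<phi> (ereal \<phi>)"

text \<open>\<open>m\<close> is the (attained) minimum of \<open>f\<close> over \<open>S\<close>.\<close>

definition is_min_value :: "('a \<Rightarrow> ereal) \<Rightarrow> 'a set \<Rightarrow> ereal \<Rightarrow> bool" where
  "is_min_value f S m \<longleftrightarrow> (\<exists>x\<in>S. f x = m) \<and> (\<forall>x\<in>S. m \<le> f x)"

end

theory Submission
  imports Defs
begin

text \<open>
  Everything becomes transparent in the coordinate \<open>u = v / (1 + v)\<close>. In it the ridge risk and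
  the risk of the subagged ridgeless predictor are values of one and the same rational function
  \<open>R u = (\<rho>\<^sup>2 * (1 - u)\<^sup>2 + \<sigma>\<^sup>2) / (1 - \<phi> * u\<^sup>2)\<close>. The two families only parametrize \<open>u\<close>
  differently: a subsample aspect ratio \<open>\<theta> > 1\<close> corresponds to \<open>u = 1 / \<theta>\<close>, while a penalty
  \<open>lam > 0\<close> corresponds to the solution \<open>u\<close> of \<open>(1 - u) * (1 - \<phi> * u) = lam * u\<close> below \<open>1\<close>
  and \<open>1 / \<phi>\<close>; ridgeless regression with \<open>\<theta> < 1\<close> sits at \<open>u = 1\<close>. Both sweep out
  \<open>0 < u \<le> min 1 (1 / \<phi>)\<close> (the end point is dropped when \<open>\<phi> = 1\<close> and there is noise, as the risk
  is infinite there), except that subagging also reaches \<open>u = 0\<close>, at \<open>\<theta> = \<infinity>\<close>. This is the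
  content of \<open>risk_subagged_ridgeless_value\<close>, \<open>risk_subagged_ridgeless_attains\<close>,
  \<open>risk_full_ridge_value\<close> and \<open>risk_full_ridge_attains\<close>.

  It remains to see that \<open>R\<close> has a minimizer \<open>w > 0\<close>. Setting \<open>R' = 0\<close> gives
  \<open>\<rho>\<^sup>2 * (1 - w) * (1 - \<phi> * w) = \<phi> * w * \<sigma>\<^sup>2\<close>, which is the equation for the penalty
  \<open>lam = \<phi> * \<sigma>\<^sup>2 / \<rho>\<^sup>2\<close>; at such a \<open>w\<close> the difference \<open>R u - R w\<close> is a nonnegative multiple of
  \<open>(u - w)\<^sup>2\<close> (\<open>risk_curve_minimal\<close>). Without signal but with noise, \<open>R\<close> is least exactly at
  \<open>u = 0\<close>, which ridge regression approaches as \<open>lam\<close> tends to infinity but never attains;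
  there the minimum over \<open>lam\<close> has to be an infimum.
\<close>

section \<open>The risk as a function of one variable\<close>

definition risk_curve :: "real \<Rightarrow> real \<Rightarrow> real \<Rightarrow> real \<Rightarrow> real" where
  "risk_curve \<rho> \<sigma> \<phi> u = (\<rho>\<^sup>2 * (1 - u)\<^sup>2 + \<sigma>\<^sup>2) / (1 - \<phi> * u\<^sup>2)"

text \<open>For \<open>0 \<le> u \<le> 1\<close> with \<open>\<phi> * u \<le> 1\<close>, the denominator of \<open>risk_curve\<close> vanishes only at
  \<open>\<phi> = u = 1\<close>. There the risk is infinite with noise and zero without; in the latter case the
  convention \<open>x / 0 = 0\<close> produces the right value, so the point can stay in the range.\<close>

definition shrinkage_range :: "real \<Rightarrow> real \<Rightarrow> real set" where
  "shrinkage_range \<sigma> \<phi> = {u. 0 \<le> u \<and> u \<le> 1 \<and> \<phi> * u \<le> 1 \<and> (\<phi> * u\<^sup>2 < 1 \<or> \<sigma> = 0)}"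

lemma shrinkage_denominator_pos:
  fixes u \<phi> :: real
  assumes "0 < u" "u < 1" "\<phi> * u \<le> 1"
  shows "\<phi> * u\<^sup>2 < 1"
proof -
  have "\<phi> * u\<^sup>2 = \<phi> * u * u" by (simp add: power2_eq_square)
  also have "\<dots> \<le> 1 * u" using assms by (intro mult_right_mono) auto
  finally show ?thesis using assms by simp
qed

lemma shrinkage_rangeI:
  assumes "0 < u" "u < 1" "\<phi> * u \<le> 1"
  shows "u \<in> shrinkage_range \<sigma> \<phi>"
  using assms shrinkage_denominator_pos[OF assms] by (simp add: shrinkage_range_def)

lemma v_tilde_ratio:
  fixes u \<phi> :: real
  assumes "0 < u" "u < 1" "v = u / (1 - u)"
  shows "(\<phi> / (1 + v)\<^sup>2) / (1 / v\<^sup>2 - \<phi> / (1 + v)\<^sup>2) = \<phi> * u\<^sup>2 / (1 - \<phi> * u\<^sup>2)"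
    and "1 / (1 + v)\<^sup>2 = (1 - u)\<^sup>2"
proof -
  have v1: "1 + v = 1 / (1 - u)" using assms by (simp add: field_simps)
  show c: "1 / (1 + v)\<^sup>2 = (1 - u)\<^sup>2" using v1 by (simp add: power_divide)
  have n: "\<phi> / (1 + v)\<^sup>2 = \<phi> * (1 - u)\<^sup>2" using v1 by (simp add: power_divide)
  have d: "1 / v\<^sup>2 = (1 - u)\<^sup>2 / u\<^sup>2" using assms by (simp add: power_divide)
  have "(1 - u)\<^sup>2 / u\<^sup>2 - \<phi> * (1 - u)\<^sup>2 = (1 - u)\<^sup>2 * (1 - \<phi> * u\<^sup>2) / u\<^sup>2"
    using assms by (simp add: field_simps)
  then show "(\<phi> / (1 + v)\<^sup>2) / (1 / v\<^sup>2 - \<phi> / (1 + v)\<^sup>2) = \<phi> * u\<^sup>2 / (1 - \<phi> * u\<^sup>2)"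
    unfolding n d using assms by simp
qed

lemma risk_curve_decomposition:
  assumes "\<phi> * u\<^sup>2 < 1"
  shows "\<sigma>\<^sup>2 + \<rho>\<^sup>2 * (1 + \<phi> * u\<^sup>2 / (1 - \<phi> * u\<^sup>2)) * (1 - u)\<^sup>2 + \<sigma>\<^sup>2 * (\<phi> * u\<^sup>2 / (1 - \<phi> * u\<^sup>2))
    = risk_curve \<rho> \<sigma> \<phi> u"
proof -
  define d where "d = 1 - \<phi> * u\<^sup>2"
  have d: "d > 0" and \<phi>u: "\<phi> * u\<^sup>2 = 1 - d" using assms by (auto simp: d_def)
  show ?thesis unfolding risk_curve_def \<phi>u using d by (simp add: field_simps)
qed

text \<open>The passage from \<open>v\<close> to \<open>u\<close> covers both families at once: ridge regression is the case
  \<open>\<theta> = \<phi>\<close>, ridgeless regression the case \<open>lam = 0\<close>.\<close>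

lemma risk_eq_risk_curve:
  assumes u: "0 < u" "u < 1" "\<phi> * u \<le> 1"
    and v: "v_fp lam \<theta> = ereal (u / (1 - u))" and nd: "lam \<noteq> 0 \<or> \<theta> > 1"
  shows "ereal (\<sigma>\<^sup>2) + bias_lim \<rho> lam \<phi> (ereal \<theta>) + var_lim \<sigma> lam \<phi> (ereal \<theta>)
    = ereal (risk_curve \<rho> \<sigma> \<phi> u)"
proof -
  have "v_tilde lam \<phi> (ereal \<theta>) = \<phi> * u\<^sup>2 / (1 - \<phi> * u\<^sup>2)"
    using v_tilde_ratio(1)[OF u(1,2) refl, of \<phi>] v by (simp add: v_tilde_def)
  moreover have "c_tilde lam (ereal \<theta>) = (1 - u)\<^sup>2"
    using v_tilde_ratio(2)[OF u(1,2) refl] v by (simp add: c_tilde_def)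
  ultimately show ?thesis
    using nd risk_curve_decomposition[OF shrinkage_denominator_pos[OF u], of \<sigma> \<rho>]
    by (auto simp: bias_lim_def var_lim_def)
qed

section \<open>Solving the fixed-point equation\<close>

lemma v_pos_eqI:
  assumes "lam > 0" "\<theta> > 0" "v \<ge> 0" "1 / v = lam + \<theta> / (1 + v)"
  shows "v_pos lam \<theta> = v"
  unfolding v_pos_def using v_pos_ex1[OF assms(1,2)] assms(3,4) by (intro the1_equality) auto

lemma v_pos_of_shrinkage:
  assumes "\<theta> > 0" "lam > 0" "0 < u" "u < 1" "(1 - u) * (1 - \<theta> * u) = lam * u"
  shows "v_pos lam \<theta> = u / (1 - u)"
proof (rule v_pos_eqI)
  have "1 + u / (1 - u) = 1 / (1 - u)" using assms by (simp add: field_simps)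
  moreover have "(1 - u) / u = lam + \<theta> * (1 - u)"
    using assms by (simp add: field_simps)
  ultimately show "1 / (u / (1 - u)) = lam + \<theta> / (1 + u / (1 - u))" by simp
qed (use assms in auto)

lemma shrinkage_of_penalty:
  fixes lam \<theta> :: real
  assumes "\<theta> > 0" "lam > 0"
  obtains u where "0 < u" "u < 1" "\<theta> * u < 1" "(1 - u) * (1 - \<theta> * u) = lam * u"
proof -
  obtain v where v: "v \<ge> 0" "1 / v = lam + \<theta> / (1 + v)"
    using v_pos_ex1[OF assms(2,1)] by blast
  have "v \<noteq> 0"
  proof
    assume "v = 0"
    then show False using v assms by simp
  qed
  then have v0: "v > 0" using v by simp
  define u where "u = v / (1 + v)"
  have u: "0 < u" "u < 1" using v0 by (auto simp: u_def)
  have "1 - u = 1 / (1 + v)" using v0 by (simp add: u_def field_simps)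
  moreover have "1 - \<theta> * u = lam * v"
  proof -
    define p q where "p = 1 / v" and "q = \<theta> / (1 + v)"
    have "1 + v \<noteq> 0" using v0 by simp
    then have qp: "q * (1 + v) = \<theta>" "p * v = 1" using v0 by (simp_all only: p_def q_def) simp_all
    have lam: "lam = p - q" using v(2) by (simp add: p_def q_def)
    have "lam * v * (1 + v) = p * v * (1 + v) - q * (1 + v) * v"
      unfolding lam by (simp add: algebra_simps)
    then have "1 + v - \<theta> * v = lam * v * (1 + v)" by (simp only: qp mult_1)
    moreover have "1 - \<theta> * u = (1 + v - \<theta> * v) / (1 + v)"
      using v0 by (simp add: u_def diff_divide_distrib)
    ultimately show ?thesis using v0 by simp
  qed
  ultimately have eq: "(1 - u) * (1 - \<theta> * u) = lam * u" and pos: "1 - \<theta> * u > 0"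
    using assms v0 by (auto simp: u_def)
  show thesis by (rule that[OF u _ eq]) (use pos in simp)
qed

text \<open>The positive root of the quadratic equation for \<open>v\<close>, with the radical in the denominator
  so that \<open>lam\<close> can be sent to \<open>0\<close>.\<close>

lemma v_pos_closed_form:
  assumes "lam > 0" "\<theta> > 1"
  shows "v_pos lam \<theta> = 2 / (sqrt ((lam + \<theta> - 1)\<^sup>2 + 4 * lam) + (lam + \<theta> - 1))"
proof (rule v_pos_eqI)
  define b where "b = lam + \<theta> - 1"
  define r where "r = sqrt (b\<^sup>2 + 4 * lam)"
  define v where "v = 2 / (r + b)"
  have b: "b > 0" using assms by (simp add: b_def)
  have r0: "r \<ge> 0" and r2: "r\<^sup>2 = b\<^sup>2 + 4 * lam" using assms by (auto simp: r_def)
  have v: "v > 0" using b r0 by (simp add: v_def)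
  have "r + b \<noteq> 0" using b r0 by simp
  then have "v * (r + b) = 2" using v_def nonzero_eq_divide_eq by blast
  then have "v * r = 2 - v * b" by (simp add: algebra_simps)
  then have "v\<^sup>2 * r\<^sup>2 = (2 - v * b)\<^sup>2" by (metis power_mult_distrib)
  then have "4 * (lam * v\<^sup>2 + b * v) = 4"
    using r2 by algebra
  then have quad: "lam * v\<^sup>2 + b * v = 1" by simp
  show "1 / (2 / (sqrt ((lam + \<theta> - 1)\<^sup>2 + 4 * lam) + (lam + \<theta> - 1))) =
      lam + \<theta> / (1 + 2 / (sqrt ((lam + \<theta> - 1)\<^sup>2 + 4 * lam) + (lam + \<theta> - 1)))"
  proof -
    have "1 / v = lam + \<theta> / (1 + v)"
      using v quad by (simp add: b_def field_simps power2_eq_square)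
    then show ?thesis by (simp add: v_def r_def b_def)
  qed
  show "0 \<le> 2 / (sqrt ((lam + \<theta> - 1)\<^sup>2 + 4 * lam) + (lam + \<theta> - 1))"
    using v by (simp add: v_def r_def b_def)
qed (use assms in auto)

lemma v_fp_ridgeless:
  assumes "\<theta> > 1"
  shows "v_fp 0 \<theta> = ereal (1 / (\<theta> - 1))"
proof -
  have "((\<lambda>l. 2 / (sqrt ((l + \<theta> - 1)\<^sup>2 + 4 * l) + (l + \<theta> - 1))) \<longlongrightarrow>
      2 / (sqrt ((0 + \<theta> - 1)\<^sup>2 + 4 * 0) + (0 + \<theta> - 1))) (at_right 0)"
    using assms by (intro tendsto_intros) auto
  moreover have "2 / (sqrt ((0 + \<theta> - 1)\<^sup>2 + 4 * 0) + (0 + \<theta> - 1)) = 1 / (\<theta> - 1)"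
    using assms by (simp add: field_simps)
  ultimately have "((\<lambda>l. 2 / (sqrt ((l + \<theta> - 1)\<^sup>2 + 4 * l) + (l + \<theta> - 1))) \<longlongrightarrow> 1 / (\<theta> - 1))
      (at_right 0)"
    by simp
  moreover have "\<forall>\<^sub>F l in at_right 0.
      2 / (sqrt ((l + \<theta> - 1)\<^sup>2 + 4 * l) + (l + \<theta> - 1)) = v_pos l \<theta>"
    using eventually_at_right_less[of "0 :: real"]
    by eventually_elim (simp add: v_pos_closed_form assms)
  ultimately have "((\<lambda>l. v_pos l \<theta>) \<longlongrightarrow> 1 / (\<theta> - 1)) (at_right 0)"
    by (rule Lim_transform_eventually)
  then have "Lim (at_right 0) (\<lambda>l. v_pos l \<theta>) = 1 / (\<theta> - 1)"
    by (intro tendsto_Lim) auto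
  then show ?thesis using assms by (simp add: v_fp_def)
qed

section \<open>Both families of risks lie on the curve\<close>

lemma ridgeless_risk_gt1:
  assumes "\<theta> > 1" "\<phi> \<le> \<theta>"
  shows "ereal (\<sigma>\<^sup>2) + bias_lim \<rho> 0 \<phi> (ereal \<theta>) + var_lim \<sigma> 0 \<phi> (ereal \<theta>)
    = ereal (risk_curve \<rho> \<sigma> \<phi> (1 / \<theta>))"
proof (rule risk_eq_risk_curve)
  have "1 / \<theta> / (1 - 1 / \<theta>) = 1 / (\<theta> - 1)" using assms by (simp add: field_simps)
  then show "v_fp 0 \<theta> = ereal (1 / \<theta> / (1 - 1 / \<theta>))" using v_fp_ridgeless assms by simp
qed (use assms in auto)

lemma ridgeless_risk_lt1:
  assumes "\<theta> < 1" "\<phi> \<le> \<theta>"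
  shows "ereal (\<sigma>\<^sup>2) + bias_lim \<rho> 0 \<phi> (ereal \<theta>) + var_lim \<sigma> 0 \<phi> (ereal \<theta>)
    = ereal (risk_curve \<rho> \<sigma> \<phi> 1)"
  using assms by (auto simp: bias_lim_def var_lim_def risk_curve_def field_simps)

lemma ridgeless_risk_eq1:
  "ereal (\<sigma>\<^sup>2) + bias_lim \<rho> 0 \<phi> (ereal 1) + var_lim \<sigma> 0 \<phi> (ereal 1)
    = (if \<sigma> = 0 then ereal (risk_curve \<rho> \<sigma> \<phi> 1) else \<infinity>)"
  by (auto simp: bias_lim_def var_lim_def risk_curve_def zero_ereal_def one_ereal_def)

text \<open>The infinite alternative is the interpolation threshold \<open>\<theta> = 1\<close> with noise. The risk jumps
  to \<open>\<infinity>\<close> there even if \<open>\<phi> < 1\<close>, where \<open>risk_curve\<close> stays finite; an infinite value never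
  lowers a minimum, so it may leave the curve.\<close>

lemma ridgeless_risk_value:
  assumes "\<phi> \<le> \<theta>" "\<theta> > 0"
  shows "ereal (\<sigma>\<^sup>2) + bias_lim \<rho> 0 \<phi> (ereal \<theta>) + var_lim \<sigma> 0 \<phi> (ereal \<theta>) = \<infinity> \<or>
    (\<exists>u\<in>shrinkage_range \<sigma> \<phi>. ereal (\<sigma>\<^sup>2) + bias_lim \<rho> 0 \<phi> (ereal \<theta>) + var_lim \<sigma> 0 \<phi> (ereal \<theta>)
      = ereal (risk_curve \<rho> \<sigma> \<phi> u))"
proof -
  consider "\<theta> > 1" | "\<theta> = 1" | "\<theta> < 1" by linarith
  then show ?thesis
  proof cases
    case 1
    then have "1 / \<theta> \<in> shrinkage_range \<sigma> \<phi>"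
      using assms by (intro shrinkage_rangeI) auto
    then show ?thesis using ridgeless_risk_gt1[OF 1 assms(1)] by blast
  next
    case 2
    then have "1 \<in> shrinkage_range \<sigma> \<phi>" if "\<sigma> = 0"
      using assms that by (auto simp: shrinkage_range_def)
    then show ?thesis using ridgeless_risk_eq1 2 by metis
  next
    case 3
    then have "1 \<in> shrinkage_range \<sigma> \<phi>"
      using assms by (auto simp: shrinkage_range_def)
    then show ?thesis using ridgeless_risk_lt1[OF 3 assms(1)] by blast
  qed
qed

text \<open>On the full data, ridgeless regression realizes the right end \<open>min 1 (1 / \<phi>)\<close> of the range.
  This point is the limit \<open>lam \<rightarrow> 0\<close> of the ridge family, and for subagging it covers \<open>u = 1\<close>,
  which no \<open>\<theta> > 1\<close> reaches.\<close>

lemma ridgeless_full_risk_endpoint: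
  assumes "\<phi> > 0" "u \<in> shrinkage_range \<sigma> \<phi>" "u = 1 \<or> \<phi> * u = 1"
  shows "ereal (\<sigma>\<^sup>2) + bias_lim \<rho> 0 \<phi> (ereal \<phi>) + var_lim \<sigma> 0 \<phi> (ereal \<phi>)
    = ereal (risk_curve \<rho> \<sigma> \<phi> u)"
proof -
  have u: "0 \<le> u" "u \<le> 1" "\<phi> * u \<le> 1" "\<phi> * u\<^sup>2 < 1 \<or> \<sigma> = 0"
    using assms(2) by (auto simp: shrinkage_range_def)
  consider "\<phi> > 1" | "\<phi> = 1" | "\<phi> < 1" by linarith
  then show ?thesis
  proof cases
    case 1
    then have "u = 1 / \<phi>" using assms u by (auto simp: field_simps)
    then show ?thesis using ridgeless_risk_gt1[OF 1 order_refl] by simp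
  next
    case 2
    then have "u = 1" using assms by auto
    then show ?thesis using ridgeless_risk_eq1[of \<sigma> \<rho> \<phi>] u 2 by auto
  next
    case 3
    have "u = 1"
    proof (rule ccontr)
      assume "u \<noteq> 1"
      moreover have "\<phi> * u \<le> u" using u 3 assms(1) by (simp add: mult_left_le_one_le)
      ultimately show False using u assms(3) by auto
    qed
    then show ?thesis using ridgeless_risk_lt1[OF 3 order_refl] by simp
  qed
qed

lemma subagged_risk_no_data:
  "risk_subagged_ridgeless \<rho> \<sigma> \<phi> \<infinity> = ereal (risk_curve \<rho> \<sigma> \<phi> 0)"
  by (simp add: risk_subagged_ridgeless_def bias_lim_def var_lim_def v_tilde_def c_tilde_def
      risk_curve_def)

lemma risk_subagged_ridgeless_value:
  assumes "\<phi> > 0" "ereal \<phi> \<le> \<theta>"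
  shows "risk_subagged_ridgeless \<rho> \<sigma> \<phi> \<theta> = \<infinity> \<or>
    (\<exists>u\<in>shrinkage_range \<sigma> \<phi>. risk_subagged_ridgeless \<rho> \<sigma> \<phi> \<theta> = ereal (risk_curve \<rho> \<sigma> \<phi> u))"
proof (cases \<theta>)
  case (real t)
  then show ?thesis
    using ridgeless_risk_value[of \<phi> t] assms unfolding risk_subagged_ridgeless_def by simp
next
  case PInf
  have "0 \<in> shrinkage_range \<sigma> \<phi>" by (simp add: shrinkage_range_def)
  then show ?thesis using PInf subagged_risk_no_data by blast
qed (use assms in auto)

lemma risk_subagged_ridgeless_attains:
  assumes "\<phi> > 0" "u \<in> shrinkage_range \<sigma> \<phi>"
  shows "\<exists>\<theta>\<in>{ereal \<phi>..\<infinity>}. risk_subagged_ridgeless \<rho> \<sigma> \<phi> \<theta> = ereal (risk_curve \<rho> \<sigma> \<phi> u)"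
proof -
  consider "u = 0" | "u = 1" | "0 < u" "u < 1" "\<phi> * u \<le> 1"
    using assms(2) by (force simp: shrinkage_range_def)
  then show ?thesis
  proof cases
    case 1
    then show ?thesis using subagged_risk_no_data by (intro bexI[of _ \<infinity>]) auto
  next
    case 2
    then show ?thesis
      using ridgeless_full_risk_endpoint[OF assms]
      by (intro bexI[of _ "ereal \<phi>"]) (auto simp: risk_subagged_ridgeless_def)
  next
    case 3
    then have "\<phi> \<le> 1 / u" "1 / u > 1" by (auto simp: field_simps)
    then show ?thesis
      using ridgeless_risk_gt1[of "1 / u" \<phi> \<sigma> \<rho>]
      by (intro bexI[of _ "ereal (1 / u)"]) (auto simp: risk_subagged_ridgeless_def)
  qed
qed

lemma risk_full_ridge_of_shrinkage:
  assumes "\<phi> > 0" "lam > 0" "0 < u" "u < 1" "\<phi> * u \<le> 1" "(1 - u) * (1 - \<phi> * u) = lam * u"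
  shows "risk_full_ridge \<rho> \<sigma> lam \<phi> = ereal (risk_curve \<rho> \<sigma> \<phi> u)"
  unfolding risk_full_ridge_def
  using assms v_pos_of_shrinkage[of \<phi> lam u] by (intro risk_eq_risk_curve) (auto simp: v_fp_def)

lemma risk_full_ridge_value:
  assumes "\<phi> > 0" "lam \<ge> 0"
  shows "risk_full_ridge \<rho> \<sigma> lam \<phi> = \<infinity> \<or>
    (\<exists>u\<in>shrinkage_range \<sigma> \<phi>. risk_full_ridge \<rho> \<sigma> lam \<phi> = ereal (risk_curve \<rho> \<sigma> \<phi> u))"
proof (cases "lam = 0")
  case True
  then show ?thesis
    using ridgeless_risk_value[of \<phi> \<phi>] assms unfolding risk_full_ridge_def by simp
next
  case False
  then have lam: "lam > 0" using assms by simp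
  obtain u where "0 < u" "u < 1" "\<phi> * u < 1" "(1 - u) * (1 - \<phi> * u) = lam * u"
    using shrinkage_of_penalty[OF assms(1) lam] .
  then have "u \<in> shrinkage_range \<sigma> \<phi>"
      "risk_full_ridge \<rho> \<sigma> lam \<phi> = ereal (risk_curve \<rho> \<sigma> \<phi> u)"
    using assms lam by (auto intro: shrinkage_rangeI risk_full_ridge_of_shrinkage)
  then show ?thesis by blast
qed

lemma risk_full_ridge_attains:
  assumes "\<phi> > 0" "u \<in> shrinkage_range \<sigma> \<phi>" "u > 0"
  shows "\<exists>lam\<in>{0..}. risk_full_ridge \<rho> \<sigma> lam \<phi> = ereal (risk_curve \<rho> \<sigma> \<phi> u)"
proof (cases "u = 1 \<or> \<phi> * u = 1")
  case True
  then show ?thesis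
    using ridgeless_full_risk_endpoint[OF assms(1,2)]
    by (intro bexI[of _ 0]) (auto simp: risk_full_ridge_def)
next
  case False
  then have u: "u < 1" "\<phi> * u < 1" using assms by (auto simp: shrinkage_range_def)
  define lam where "lam = (1 - u) * (1 - \<phi> * u) / u"
  have "lam > 0" using u assms by (simp add: lam_def)
  moreover have "(1 - u) * (1 - \<phi> * u) = lam * u" using assms by (simp add: lam_def)
  ultimately show ?thesis
    using risk_full_ridge_of_shrinkage[of \<phi> lam u] u assms by (intro bexI[of _ lam]) auto
qed

section \<open>Minimizing the curve\<close>

text \<open>The stationarity equation turns the value at \<open>w\<close> into \<open>\<rho>\<^sup>2 * (1 - w) / (\<phi> * w)\<close>, and against
  this value the numerator of \<open>risk_curve\<close> minus the matching multiple of the denominator is a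
  square.\<close>

lemma risk_curve_minimal:
  assumes \<phi>: "\<phi> > 0" and w: "w \<in> shrinkage_range \<sigma> \<phi>" "w > 0"
    and stat: "\<rho>\<^sup>2 * (1 - w) * (1 - \<phi> * w) = \<phi> * w * \<sigma>\<^sup>2"
    and u: "u \<in> shrinkage_range \<sigma> \<phi>"
  shows "risk_curve \<rho> \<sigma> \<phi> w \<le> risk_curve \<rho> \<sigma> \<phi> u"
proof -
  define m where "m = \<rho>\<^sup>2 * (1 - w) / (\<phi> * w)"
  have square: "\<rho>\<^sup>2 * (1 - x)\<^sup>2 + \<sigma>\<^sup>2 - m * (1 - \<phi> * x\<^sup>2) = \<rho>\<^sup>2 * (x - w)\<^sup>2 / w" for x
  proof -
    have "\<phi> * w * m = \<rho>\<^sup>2 * (1 - w)" using \<phi> w by (simp add: m_def)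
    then have "\<phi> * ((\<rho>\<^sup>2 * (1 - x)\<^sup>2 + \<sigma>\<^sup>2 - m * (1 - \<phi> * x\<^sup>2)) * w) = \<phi> * (\<rho>\<^sup>2 * (x - w)\<^sup>2)"
      using stat by algebra
    then have "(\<rho>\<^sup>2 * (1 - x)\<^sup>2 + \<sigma>\<^sup>2 - m * (1 - \<phi> * x\<^sup>2)) * w = \<rho>\<^sup>2 * (x - w)\<^sup>2"
      using \<phi> by (simp only: mult_cancel_left) simp
    then show ?thesis using w(2) by (metis nonzero_eq_divide_eq less_irrefl)
  qed
  \<comment> \<open>At the degenerate point \<open>x = \<phi> = 1\<close> the curve has value \<open>0\<close>, and there is no noise; then
    \<open>stat\<close> forces \<open>m = 0\<close>.\<close>
  have degenerate: "risk_curve \<rho> \<sigma> \<phi> x = 0 \<and> m = 0"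
    if x: "x \<in> shrinkage_range \<sigma> \<phi>" "\<not> \<phi> * x\<^sup>2 < 1" for x
  proof -
    have x': "0 \<le> x" "x \<le> 1" "\<phi> * x \<le> 1" "\<sigma> = 0" using x by (auto simp: shrinkage_range_def)
    have "\<phi> * x\<^sup>2 = \<phi> * x * x" by (simp add: power2_eq_square)
    also have "\<dots> \<le> x" using x' \<phi> by (simp add: mult_left_le_one_le)
    finally have "x = 1" using x' x(2) by simp
    then have "\<phi> = 1" using x' x(2) by simp
    with \<open>x = 1\<close> have "risk_curve \<rho> \<sigma> \<phi> x = 0" by (simp add: risk_curve_def)
    moreover have "m = 0" using stat \<open>\<phi> = 1\<close> \<open>\<sigma> = 0\<close> by (auto simp: m_def)
    ultimately show ?thesis ..
  qed
  have "risk_curve \<rho> \<sigma> \<phi> w = m"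
  proof (cases "\<phi> * w\<^sup>2 < 1")
    case True
    then show ?thesis using square[of w] by (simp add: risk_curve_def field_simps)
  qed (use degenerate[OF w(1)] in simp)
  moreover have "m \<le> risk_curve \<rho> \<sigma> \<phi> u"
  proof (cases "\<phi> * u\<^sup>2 < 1")
    case True
    have "0 \<le> \<rho>\<^sup>2 * (u - w)\<^sup>2 / w" using w by simp
    then have "m * (1 - \<phi> * u\<^sup>2) \<le> \<rho>\<^sup>2 * (1 - u)\<^sup>2 + \<sigma>\<^sup>2" using square[of u] by linarith
    then show ?thesis using True by (simp add: risk_curve_def pos_le_divide_eq)
  qed (use degenerate[OF u] in simp)
  ultimately show ?thesis by simp
qed

text \<open>With noise the minimizer is the shrinkage of the penalty \<open>\<phi> * \<sigma>\<^sup>2 / \<rho>\<^sup>2\<close>; without noise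
  this penalty degenerates to \<open>0\<close>, whose shrinkage is the right end of the range.\<close>

lemma risk_curve_minimizer_ex:
  assumes \<phi>: "\<phi> > 0" and nd: "\<not> (\<rho>\<^sup>2 = 0 \<and> \<sigma>\<^sup>2 > 0)"
  obtains w where "w \<in> shrinkage_range \<sigma> \<phi>" "w > 0"
    "\<rho>\<^sup>2 * (1 - w) * (1 - \<phi> * w) = \<phi> * w * \<sigma>\<^sup>2"
proof (cases "\<sigma> = 0")
  case True
  define w where "w = min 1 (1 / \<phi>)"
  have "w \<le> 1" "\<phi> * w \<le> 1" "w > 0" "w = 1 \<or> \<phi> * w = 1"
    using \<phi> by (auto simp: w_def min_def field_simps)
  with True show thesis by (intro that[of w]) (auto simp: shrinkage_range_def)
next
  case False
  then have \<rho>: "\<rho>\<^sup>2 > 0" using nd by simp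
  then have "\<phi> * \<sigma>\<^sup>2 / \<rho>\<^sup>2 > 0" using \<phi> False by simp
  then obtain w where w: "0 < w" "w < 1" "\<phi> * w < 1"
      and eq: "(1 - w) * (1 - \<phi> * w) = \<phi> * \<sigma>\<^sup>2 / \<rho>\<^sup>2 * w"
    using shrinkage_of_penalty[OF \<phi>] by blast
  have "\<rho>\<^sup>2 * (1 - w) * (1 - \<phi> * w) = \<rho>\<^sup>2 * (\<phi> * \<sigma>\<^sup>2 / \<rho>\<^sup>2 * w)" using eq by (simp add: mult.assoc)
  then have "\<rho>\<^sup>2 * (1 - w) * (1 - \<phi> * w) = \<phi> * w * \<sigma>\<^sup>2" using \<rho> by simp
  with w show thesis by (intro that[of w] shrinkage_rangeI) auto
qed

lemma risk_curve_no_signal_minimal: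
  assumes "\<phi> > 0" "\<sigma> \<noteq> 0" "u \<in> shrinkage_range \<sigma> \<phi>"
  shows "\<sigma>\<^sup>2 \<le> risk_curve 0 \<sigma> \<phi> u"
proof -
  have "\<phi> * u\<^sup>2 < 1" using assms by (simp add: shrinkage_range_def)
  moreover have "\<sigma>\<^sup>2 * (1 - \<phi> * u\<^sup>2) \<le> \<sigma>\<^sup>2" using assms(1) by (simp add: algebra_simps)
  ultimately show ?thesis by (simp add: risk_curve_def pos_le_divide_eq)
qed

text \<open>Without signal, shrinking all the way to \<open>u = 0\<close> is optimal; a penalized predictor can come
  arbitrarily close to it.\<close>

lemma risk_full_ridge_INF_no_signal:
  assumes \<phi>: "\<phi> > 0" and \<sigma>: "\<sigma> \<noteq> 0"
  shows "(INF lam\<in>{0..}. risk_full_ridge 0 \<sigma> lam \<phi>) = ereal (\<sigma>\<^sup>2)"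
proof (rule antisym)
  let ?I = "INF lam\<in>{0..}. risk_full_ridge 0 \<sigma> lam \<phi>"
  have "((\<lambda>u. \<sigma>\<^sup>2 / (1 - \<phi> * u\<^sup>2)) \<longlongrightarrow> \<sigma>\<^sup>2 / (1 - \<phi> * 0\<^sup>2)) (at_right 0)"
    by (intro tendsto_intros) auto
  then have lim: "((\<lambda>u. ereal (risk_curve 0 \<sigma> \<phi> u)) \<longlongrightarrow> ereal (\<sigma>\<^sup>2)) (at_right 0)"
    by (simp add: risk_curve_def)
  have "\<forall>\<^sub>F u in at_right 0. u < min 1 (1 / \<phi>)"
    using \<phi> by (intro eventually_at_right_field[THEN iffD2] exI[of _ "min 1 (1 / \<phi>)"]) auto
  then have "\<forall>\<^sub>F u in at_right 0. ?I \<le> ereal (risk_curve 0 \<sigma> \<phi> u)"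
    using eventually_at_right_less[of "0 :: real"]
  proof eventually_elim
    case (elim u)
    then have "\<phi> * u \<le> 1" using \<phi> by (simp add: field_simps)
    then have "u \<in> shrinkage_range \<sigma> \<phi>" using elim by (intro shrinkage_rangeI) auto
    then obtain lam where "lam \<in> {0..}" "risk_full_ridge 0 \<sigma> lam \<phi> = ereal (risk_curve 0 \<sigma> \<phi> u)"
      using risk_full_ridge_attains[OF \<phi>] elim by blast
    then show ?case by (metis INF_lower)
  qed
  with lim show "?I \<le> ereal (\<sigma>\<^sup>2)" by (intro tendsto_lowerbound) auto
  show "ereal (\<sigma>\<^sup>2) \<le> ?I"
  proof (rule INF_greatest)
    fix lam :: real assume "lam \<in> {0..}"
    then show "ereal (\<sigma>\<^sup>2) \<le> risk_full_ridge 0 \<sigma> lam \<phi>"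
      using risk_full_ridge_value[OF \<phi>, of lam 0 \<sigma>] risk_curve_no_signal_minimal[OF \<phi> \<sigma>]
      by force
  qed
qed

section \<open>Equality of the optimal risks\<close>

theorem theorem5p3:
  fixes \<rho> \<sigma> \<phi> :: real
  assumes "\<phi> > 0"
  shows "\<exists>m. is_min_value (\<lambda>\<phi>\<^sub>s. risk_subagged_ridgeless \<rho> \<sigma> \<phi> \<phi>\<^sub>s) {ereal \<phi>..\<infinity>} m \<and>
           (if \<rho>\<^sup>2 = 0 \<and> \<sigma>\<^sup>2 > 0
            then (INF lam\<in>{0..}. risk_full_ridge \<rho> \<sigma> lam \<phi>) = m
            else is_min_value (\<lambda>lam. risk_full_ridge \<rho> \<sigma> lam \<phi>) {0..} m)"
proof -
  have subagged: "is_min_value (\<lambda>\<phi>\<^sub>s. risk_subagged_ridgeless \<rho> \<sigma> \<phi> \<phi>\<^sub>s) {ereal \<phi>..\<infinity>}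
      (ereal (risk_curve \<rho> \<sigma> \<phi> w))"
    if "w \<in> shrinkage_range \<sigma> \<phi>"
      "\<And>u. u \<in> shrinkage_range \<sigma> \<phi> \<Longrightarrow> risk_curve \<rho> \<sigma> \<phi> w \<le> risk_curve \<rho> \<sigma> \<phi> u" for w
    unfolding is_min_value_def
  proof (intro conjI ballI)
    fix \<theta> assume "\<theta> \<in> {ereal \<phi>..\<infinity>}"
    then show "ereal (risk_curve \<rho> \<sigma> \<phi> w) \<le> risk_subagged_ridgeless \<rho> \<sigma> \<phi> \<theta>"
      using risk_subagged_ridgeless_value[OF assms, of \<theta> \<rho> \<sigma>] that(2) by force
  qed (rule risk_subagged_ridgeless_attains[OF assms that(1)])
  show ?thesis
  proof (cases "\<rho>\<^sup>2 = 0 \<and> \<sigma>\<^sup>2 > 0")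
    case True
    then have \<rho>: "\<rho> = 0" and \<sigma>: "\<sigma> \<noteq> 0" by auto
    have zero: "risk_curve \<rho> \<sigma> \<phi> 0 = \<sigma>\<^sup>2" using \<rho> by (simp add: risk_curve_def)
    have "is_min_value (\<lambda>\<phi>\<^sub>s. risk_subagged_ridgeless \<rho> \<sigma> \<phi> \<phi>\<^sub>s) {ereal \<phi>..\<infinity>}
        (ereal (risk_curve \<rho> \<sigma> \<phi> 0))"
      using risk_curve_no_signal_minimal[OF assms \<sigma>] zero \<rho>
      by (intro subagged) (auto simp: shrinkage_range_def)
    then show ?thesis
      using True zero \<rho> risk_full_ridge_INF_no_signal[OF assms \<sigma>] by auto
  next
    case False
    obtain w where w: "w \<in> shrinkage_range \<sigma> \<phi>" "w > 0"
        "\<rho>\<^sup>2 * (1 - w) * (1 - \<phi> * w) = \<phi> * w * \<sigma>\<^sup>2"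
      using risk_curve_minimizer_ex[OF assms False] .
    note minimal = risk_curve_minimal[OF assms w]
    have "is_min_value (\<lambda>lam. risk_full_ridge \<rho> \<sigma> lam \<phi>) {0..} (ereal (risk_curve \<rho> \<sigma> \<phi> w))"
      unfolding is_min_value_def
    proof (intro conjI ballI)
      fix lam :: real assume "lam \<in> {0..}"
      then show "ereal (risk_curve \<rho> \<sigma> \<phi> w) \<le> risk_full_ridge \<rho> \<sigma> lam \<phi>"
        using risk_full_ridge_value[OF assms, of lam \<rho> \<sigma>] minimal by force
    qed (rule risk_full_ridge_attains[OF assms w(1,2)])
    with subagged[OF w(1) minimal] False show ?thesis by auto
  qed
qed

end
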